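(* Let $\mu_1$ be a suitable probability on $\Omega$ and $J$ a Jacobian (of a $\sigma$-invariant probability $\mu$). Let $\mu_2=\mathcal L^*_{\log J}(\mu_1)$, and denote by $J_1$ and $J_2$ the IRNs of $\mu_1$ and $\mu_2$ respectively. If $$1-\int\sum_{a=1}^d\frac{J(ax)^2}{J(x)}\,d\mu_1(x)\ \ge\ 0,$$ then the pair $(J,\mu_1)$ satisfies the Second Law of Thermodynamics, that is, $$h(\mathcal L^*_{\log J}(\mu_1))=h(\mu_2)=-\int\log J_2\,d\mu_2\ \ge\ -\int\log J_1\,d\mu_1=h(\mu_1).$$
   Context: Let $d\ge 2$, $\Omega=\{1,\dots,d\}^{\mathbb N}$ with metric $d(x,y)=2^{-N}$, where $N$ is the smallest $j$ with $x_j\ne y_j$ (and $d(x,x)=0$), and let $\sigma:\Omega\to\Omega$ be the shift $\sigma(x_1,x_2,\dots)=(x_2,x_3,\dots)$. For $a\in\{1,\dots,d\}$ and $x\in\Omega$ write $ax=(a,x_1,x_2,\dots)$, and let $\overline a=\{ax: x\in\Omega\}$. IRN and suitable probabilities: a Borel probability $\mu$ on $\Omega$ (not necessarily $\sigma$-invariant) is called suitable if there is a continuous, strictly positive function $J_\mu:\Omega\to\mathbb R$ such that $\mu(\sigma(B))=\int_B J_\mu^{-1}\,d\mu$ for every $j\in\{1,\dots,d\}$ and every Borel set $B\subset\overline j$; equivalently, for every $j$ and every continuous $\varphi$ vanishing outside $\overline j$, $\int\varphi(jx)J_\mu(jx)\,d\mu(x)=\int\varphi\,d\mu$. The function $J_\mu$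 is called the IRN of $\mu$; a suitable probability has full support, so $J_\mu$ is unique. Jacobian: a continuous positive function $J:\Omega\to(0,1)$ with $\sum_{a=1}^d J(ax)=1$ for all $x\in\Omega$; equivalently, the IRN of a suitable $\sigma$-invariant probability. Dual Ruelle operator: $\mathcal L_{\log J}(\varphi)(x)=\sum_{a=1}^d J(ax)\varphi(ax)$ for continuous $\varphi$, and $\int\varphi\,d\mathcal L_{\log J}^*(\rho)=\int\mathcal L_{\log J}(\varphi)\,d\rho$ for all continuous $\varphi$. If $\mu$ is suitable and $J$ is a continuous Jacobian, $\mathcal L_{\log J}^*(\mu)$ is again a suitable probability. Entropy: for a suitable probability $\mu$ with IRN $J_\mu$ (not necessarily invariant), $h(\mu):=-\int\log J_\mu\,d\mu$. *)

theory Defs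
  imports "HOL-Probability.Probability"
begin

text \<open>
  Sequences over the alphabet {1..d}, embedded in the type of functions on the naturals.
  Positions are counted from 0, so x 0 is the first symbol of x.
\<close>

definition Omega :: "nat \<Rightarrow> (nat \<Rightarrow> nat) set" where
  "Omega d = {x. \<forall>i. x i \<in> {1..d}}"

definition shift :: "(nat \<Rightarrow> nat) \<Rightarrow> (nat \<Rightarrow> nat)" where
  "shift x = (\<lambda>n. x (Suc n))"

definition scons :: "nat \<Rightarrow> (nat \<Rightarrow> nat) \<Rightarrow> (nat \<Rightarrow> nat)" where
  "scons a x = (\<lambda>n. case n of 0 \<Rightarrow> a | Suc m \<Rightarrow> x m)"

definition cylinder :: "nat \<Rightarrow> nat \<Rightarrow> (nat \<Rightarrow> nat) set" where
  "cylinder d a = scons a ` Omega d"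

definition omega_dist :: "(nat \<Rightarrow> nat) \<Rightarrow> (nat \<Rightarrow> nat) \<Rightarrow> real" where
  "omega_dist x y = (if x = y then 0 else (1/2) ^ Suc (LEAST j. x j \<noteq> y j))"

text \<open>
  The metric omega_dist induces on Omega the topology inherited from the library's product
  topology on functions (with discrete factors).  Hence continuity and Borel sets can be
  expressed below with the library's constants continuous_on and borel.
\<close>

lemma omega_dist_lt_iff: "omega_dist x y < (1/2) ^ n \<longleftrightarrow> (\<forall>i<n. x i = y i)"
proof (cases "x = y")
  case True
  then show ?thesis by (simp add: omega_dist_def)
next
  case False
  define k where "k = (LEAST j. x j \<noteq> y j)"
  have ne: "x k \<noteq> y k"
    unfolding k_def by (rule LeastI_ex) (use False in auto)
  have eq: "x i = y i" if "i < k" for i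
    using that not_less_Least unfolding k_def by blast
  have "omega_dist x y = (1/2) ^ Suc k"
    using False by (simp add: omega_dist_def k_def)
  moreover have "((1/2::real) ^ Suc k < (1/2) ^ n) \<longleftrightarrow> n < Suc k"
    by (rule power_strict_decreasing_iff) auto
  moreover have "n < Suc k \<longleftrightarrow> (\<forall>i<n. x i = y i)"
    using ne eq by (meson less_Suc_eq_le less_le_trans not_less)
  ultimately show ?thesis by metis
qed

lemma omega_dist_sym: "omega_dist x y = omega_dist y x"
  unfolding omega_dist_def by (simp add: eq_commute)

lemma omega_dist_ultra: "omega_dist x z \<le> max (omega_dist x y) (omega_dist y z)"
proof (cases "x = z")
  case True
  then show ?thesis by (auto simp: omega_dist_def le_max_iff_disj)
next
  case False
  define k where "k = (LEAST j. x j \<noteq> z j)"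
  have *: "omega_dist x z = (1/2) ^ Suc k"
    using False by (simp add: omega_dist_def k_def)
  have ne: "x k \<noteq> z k"
    unfolding k_def by (rule LeastI_ex) (use False in auto)
  have "\<not> (omega_dist x y < (1/2) ^ Suc k \<and> omega_dist y z < (1/2) ^ Suc k)"
    unfolding omega_dist_lt_iff using ne by auto
  then show ?thesis unfolding * by (auto simp: le_max_iff_disj not_less)
qed

lemma Metric_space_Omega: "Metric_space (Omega d) omega_dist"
proof
  show nonneg: "0 \<le> omega_dist x y" for x y
    by (simp add: omega_dist_def)
  show "omega_dist x y = omega_dist y x" for x y
    by (rule omega_dist_sym)
  show "omega_dist x y = 0 \<longleftrightarrow> x = y" for x y
    by (simp add: omega_dist_def)
  show "omega_dist x z \<le> omega_dist x y + omega_dist y z" for x y z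
    using omega_dist_ultra[of x z y] nonneg[of x y] nonneg[of y z] by linarith
qed

lemma mtopology_Omega:
  "Metric_space.mtopology (Omega d) omega_dist = top_of_set (Omega d)"
proof -
  interpret Metric_space "Omega d" omega_dist by (rule Metric_space_Omega)
  have "openin mtopology U" if U: "openin (top_of_set (Omega d)) U" for U
  proof -
    obtain T where T: "open T" "U = Omega d \<inter> T"
      using U by (auto simp: openin_open)
    have "\<exists>r>0. mball x r \<subseteq> U" if x: "x \<in> U" for x
    proof -
      have "openin (product_topology (\<lambda>_. euclidean) UNIV) T"
        using T(1) by (simp add: open_fun_def)
      moreover have "x \<in> T" using x T by auto
      ultimately obtain X where X: "x \<in> (\<Pi>\<^sub>E i\<in>UNIV. X i)"
          "finite {i. X i \<noteq> topspace (euclidean :: nat topology)}"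
          "(\<Pi>\<^sub>E i\<in>UNIV. X i) \<subseteq> T"
        using product_topology_open_contains_basis[of "\<lambda>_::nat. euclidean :: nat topology" UNIV T x]
        by blast
      obtain n where n: "\<forall>i\<in>{i. X i \<noteq> UNIV}. i < n"
        using X(2) finite_nat_set_iff_bounded by auto
      have "y \<in> U" if y: "y \<in> mball x ((1/2) ^ n)" for y
      proof -
        have "omega_dist x y < (1/2) ^ n" and yO: "y \<in> Omega d"
          using y by auto
        then have "\<forall>i<n. x i = y i" by (simp only: omega_dist_lt_iff)
        moreover have "x i \<in> X i" for i using X(1) by (simp add: PiE_iff)
        ultimately have "y i \<in> X i" for i using n by (metis (mono_tags) UNIV_I mem_Collect_eq)
        then have "y \<in> T" using X(3) by auto
        then show ?thesis using yO T by blast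
      qed
      then show ?thesis by (intro exI[of _ "(1/2) ^ n"]) auto
    qed
    then show ?thesis unfolding openin_mtopology using T by blast
  qed
  moreover have "openin (top_of_set (Omega d)) U" if U: "openin mtopology U" for U
  proof (subst openin_subopen, intro ballI)
    fix x assume x: "x \<in> U"
    from U x obtain r where r: "r > 0" "mball x r \<subseteq> U" and sub: "U \<subseteq> Omega d"
      unfolding openin_mtopology by blast
    obtain n where n: "(1/2::real) ^ n < r"
      using real_arch_pow_inv[OF r(1), of "1/2"] by auto
    define X where "X i = (if i < n then {x i} else UNIV)" for i
    have "open (Pi\<^sub>E UNIV X)"
    proof (rule open_PiE)
      show "open (X i)" for i by (rule Topological_Spaces.open_discrete)
      show "finite {i. X i \<noteq> UNIV}"
        by (rule finite_subset[of _ "{..<n}"]) (auto simp: X_def)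
    qed
    then have "openin (top_of_set (Omega d)) (Omega d \<inter> Pi\<^sub>E UNIV X)" by blast
    moreover have "x \<in> Omega d \<inter> Pi\<^sub>E UNIV X"
      using x sub by (auto simp: X_def)
    moreover have "Omega d \<inter> Pi\<^sub>E UNIV X \<subseteq> U"
    proof
      fix y assume y: "y \<in> Omega d \<inter> Pi\<^sub>E UNIV X"
      then have "\<forall>i<n. x i = y i" by (auto simp: PiE_iff X_def split: if_splits)
      then have "omega_dist x y < (1/2) ^ n" by (simp add: omega_dist_lt_iff)
      then have "y \<in> mball x r" using n x sub y by auto
      then show "y \<in> U" using r(2) by blast
    qed
    ultimately show "\<exists>T. openin (top_of_set (Omega d)) T \<and> x \<in> T \<and> T \<subseteq> U" by blast
  qed
  ultimately show ?thesis by (auto simp: topology_eq)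
qed

definition borel_Omega :: "nat \<Rightarrow> (nat \<Rightarrow> nat) measure" where
  "borel_Omega d = restrict_space borel (Omega d)"

definition borel_prob :: "nat \<Rightarrow> (nat \<Rightarrow> nat) measure \<Rightarrow> bool" where
  "borel_prob d \<mu> \<longleftrightarrow> sets \<mu> = sets (borel_Omega d) \<and> prob_space \<mu>"

definition is_IRN :: "nat \<Rightarrow> (nat \<Rightarrow> nat) measure \<Rightarrow> ((nat \<Rightarrow> nat) \<Rightarrow> real) \<Rightarrow> bool" where
  "is_IRN d \<mu> J \<longleftrightarrow>
     continuous_on (Omega d) J \<and> (\<forall>x\<in>Omega d. 0 < J x) \<and>
     (\<forall>j\<in>{1..d}. \<forall>B\<in>sets (borel_Omega d). B \<subseteq> cylinder d j \<longrightarrow>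
        emeasure \<mu> (shift ` B) = (\<integral>\<^sup>+x\<in>B. ennreal (inverse (J x)) \<partial>\<mu>))"

definition suitable :: "nat \<Rightarrow> (nat \<Rightarrow> nat) measure \<Rightarrow> bool" where
  "suitable d \<mu> \<longleftrightarrow> borel_prob d \<mu> \<and> (\<exists>J. is_IRN d \<mu> J)"

text \<open>
  The function required by is_IRN is unique on Omega (a suitable probability has full support);
  its irrelevant values outside Omega are the reason for using SOME instead of THE.
\<close>

definition IRN :: "nat \<Rightarrow> (nat \<Rightarrow> nat) measure \<Rightarrow> (nat \<Rightarrow> nat) \<Rightarrow> real" where
  "IRN d \<mu> = (SOME J. is_IRN d \<mu> J)"

definition is_jacobian :: "nat \<Rightarrow> ((nat \<Rightarrow> nat) \<Rightarrow> real) \<Rightarrow> bool" where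
  "is_jacobian d J \<longleftrightarrow>
     continuous_on (Omega d) J \<and> J ` Omega d \<subseteq> {0<..<1} \<and>
     (\<forall>x\<in>Omega d. (\<Sum>a=1..d. J (scons a x)) = 1)"

text \<open>The Ruelle operator with potential log J.\<close>

definition ruelle_log ::
    "nat \<Rightarrow> ((nat \<Rightarrow> nat) \<Rightarrow> real) \<Rightarrow> ((nat \<Rightarrow> nat) \<Rightarrow> real) \<Rightarrow> (nat \<Rightarrow> nat) \<Rightarrow> real" where
  "ruelle_log d J \<phi> x = (\<Sum>a=1..d. J (scons a x) * \<phi> (scons a x))"

text \<open>
  The dual operator on measures: the finite Borel measure representing the positive functional
  sending a continuous function to the integral of its image under the Ruelle operator
  (unique by the Riesz representation theorem).
\<close>

definition dual_ruelle_log ::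
    "nat \<Rightarrow> ((nat \<Rightarrow> nat) \<Rightarrow> real) \<Rightarrow> (nat \<Rightarrow> nat) measure \<Rightarrow> (nat \<Rightarrow> nat) measure" where
  "dual_ruelle_log d J \<rho> =
     (THE \<nu>. sets \<nu> = sets (borel_Omega d) \<and> finite_measure \<nu> \<and>
        (\<forall>\<phi>. continuous_on (Omega d) \<phi> \<longrightarrow>
           (\<integral>x. \<phi> x \<partial>\<nu>) = (\<integral>x. ruelle_log d J \<phi> x \<partial>\<rho>)))"

definition IRN_entropy :: "nat \<Rightarrow> (nat \<Rightarrow> nat) measure \<Rightarrow> real" where
  "IRN_entropy d \<mu> = - (\<integral>x. ln (IRN d \<mu> x) \<partial>\<mu>)"

end

theory Submission
  imports Defs
begin

text \<open>
  Write \<open>\<mu>\<close> for the given suitable probability, \<open>K\<close> for its IRN, \<open>J\<close> for the Jacobian and \<open>\<nu>\<close> for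
  the image of \<open>\<mu>\<close> under the dual operator.  The proof rests on the fact that \<open>\<nu>\<close> and its IRN are
  explicit.

  The defining property of \<open>K\<close> says that on each cylinder the shift carries the measure
  \<open>\<mu> / K\<close> to \<open>\<mu>\<close>.  Summing this change of variables over the cylinders turns the integral of
  \<open>\<Sum>a. J (scons a x) * \<phi> (scons a x)\<close> against \<open>\<mu>\<close> into that of \<open>(J / K) * \<phi>\<close>; hence \<open>\<nu>\<close> has density
  \<open>J / K\<close> with respect to \<open>\<mu>\<close> (lemma \<open>dual_ruelle_log_eq_density\<close>).  Applying the change of
  variables once more to this density shows that \<open>J x * K (shift x) / J (shift x)\<close> is an IRN of \<open>\<nu>\<close>
  (lemma \<open>is_IRN_dual_ruelle_log\<close>).

  The entropy of \<open>\<nu>\<close> is minus the \<open>\<mu>\<close>-integral of the Ruelle operator applied to the logarithm of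
  that IRN.  At a point \<open>x\<close> this image equals
  \<open>ln (K x) + (\<Sum>a. J (scons a x) * ln (J (scons a x) / J x))\<close>, because \<open>shift (scons a x) = x\<close> and the
  weights \<open>J (scons a x)\<close> add up to one.  The inequality \<open>ln t \<le> t - 1\<close> bounds the sum by
  \<open>(\<Sum>a. (J (scons a x))\<^sup>2 / J x) - 1\<close>.  So the entropy grows by at least the quantity that the theorem
  assumes to be nonnegative (lemma \<open>entropy_gain_lower_bound\<close>).

  The entropy is defined through an arbitrarily chosen IRN.  Two IRNs of the same measure are
  reciprocals of densities of the same measures on the cylinders and so agree almost everywhere,
  which makes their logarithmic integrals equal (lemma \<open>integral_ln_IRN\<close>).
\<close>

section \<open>The shift and its inverse branches\<close>

lemma scons_0 [simp]: "scons a x 0 = a"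
  by (simp add: scons_def)

lemma scons_Suc [simp]: "scons a x (Suc n) = x n"
  by (simp add: scons_def)

lemma shift_scons [simp]: "shift (scons a x) = x"
  by (simp add: shift_def)

lemma scons_shift: "x 0 = a \<Longrightarrow> scons a (shift x) = x"
  by (auto simp: scons_def shift_def fun_eq_iff split: nat.split)

lemma shift_in_Omega: "x \<in> Omega d \<Longrightarrow> shift x \<in> Omega d"
  by (simp add: Omega_def shift_def)

lemma scons_in_Omega: "a \<in> {1..d} \<Longrightarrow> x \<in> Omega d \<Longrightarrow> scons a x \<in> Omega d"
  by (auto simp: Omega_def scons_def split: nat.split)

lemma cylinder_eq: "a \<in> {1..d} \<Longrightarrow> cylinder d a = {x \<in> Omega d. x 0 = a}"
  unfolding cylinder_def
  by (auto simp: scons_in_Omega image_iff intro!: bexI[of _ "shift _"]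
      scons_shift[symmetric] shift_in_Omega)

lemma continuous_on_shift: "continuous_on S shift"
  unfolding shift_def
  by (intro continuous_on_coordinatewise_then_product
      continuous_on_subset[OF continuous_on_product_coordinates subset_UNIV])

lemma continuous_on_scons: "continuous_on S (scons a)"
proof (rule continuous_on_coordinatewise_then_product)
  fix i show "continuous_on S (\<lambda>x. scons a x i)"
    by (cases i) (auto intro: continuous_on_subset[OF continuous_on_product_coordinates])
qed

lemma continuous_on_compose_shift:
  "continuous_on (Omega d) f \<Longrightarrow> continuous_on (Omega d) (\<lambda>x. f (shift x))"
  by (rule continuous_on_compose2[OF _ continuous_on_shift]) (auto intro: shift_in_Omega)

lemma continuous_on_compose_scons:
  "a \<in> {1..d} \<Longrightarrow> continuous_on (Omega d) f \<Longrightarrow> continuous_on (Omega d) (\<lambda>x. f (scons a x))"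
  by (rule continuous_on_compose2[OF _ continuous_on_scons]) (auto intro: scons_in_Omega)

lemma compact_Omega: "compact (Omega d)"
proof -
  have "Omega d = (\<Pi>\<^sub>E i\<in>UNIV. {1..d})"
    by (auto simp: Omega_def PiE_iff)
  moreover have "compactin (product_topology (\<lambda>_::nat. euclidean :: nat topology) UNIV) (\<Pi>\<^sub>E i\<in>UNIV. {1..d})"
    by (subst compactin_PiE) (auto intro: finite_imp_compact)
  ultimately show ?thesis
    by (simp add: euclidean_product_topology)
qed

lemma continuous_on_ruelle_log:
  assumes "continuous_on (Omega d) J" "continuous_on (Omega d) f"
  shows "continuous_on (Omega d) (ruelle_log d J f)"
  unfolding ruelle_log_def
  by (intro continuous_on_sum continuous_on_mult continuous_on_compose_scons assms)

section \<open>Continuous functions and Borel measures on the sequence space\<close>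

lemma space_borel_Omega: "sets M = sets (borel_Omega d) \<Longrightarrow> space M = Omega d"
  by (simp add: sets_eq_imp_space_eq[of M "borel_Omega d"] borel_Omega_def space_restrict_space)

lemma borel_measurable_continuous_Omega:
  fixes f :: "(nat \<Rightarrow> nat) \<Rightarrow> 'b::topological_space"
  assumes "sets M = sets (borel_Omega d)" "continuous_on (Omega d) f"
  shows "f \<in> borel_measurable M"
proof -
  have "f \<in> borel_measurable (borel_Omega d)"
    unfolding borel_Omega_def by (rule borel_measurable_continuous_on_restrict[OF assms(2)])
  then show ?thesis using measurable_cong_sets[OF assms(1) refl] by blast
qed

lemma shift_measurable:
  assumes "sets M = sets (borel_Omega d)"
  shows "shift \<in> measurable M M"
proof -
  have "shift \<in> measurable M (borel_Omega d)"
    unfolding borel_Omega_def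
    by (intro measurable_restrict_space2)
      (auto simp: space_borel_Omega[OF assms] shift_in_Omega
        intro: borel_measurable_continuous_Omega[OF assms continuous_on_shift])
  then show ?thesis using measurable_cong_sets[OF refl assms] by blast
qed

lemma scons_measurable:
  assumes "sets M = sets (borel_Omega d)" "a \<in> {1..d}"
  shows "scons a \<in> measurable M M"
proof -
  have "scons a \<in> measurable M (borel_Omega d)"
    unfolding borel_Omega_def
    by (intro measurable_restrict_space2)
      (use assms(2) in \<open>auto simp: space_borel_Omega[OF assms(1)] scons_in_Omega
        intro: borel_measurable_continuous_Omega[OF assms(1) continuous_on_scons]\<close>)
  then show ?thesis using measurable_cong_sets[OF refl assms(1)] by blast
qed

lemma cylinder_in_sets:
  assumes "sets M = sets (borel_Omega d)" "a \<in> {1..d}"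
  shows "cylinder d a \<in> sets M"
proof -
  have "(\<lambda>x. x 0) \<in> measurable M (borel :: nat measure)"
    by (rule borel_measurable_continuous_Omega[OF assms(1)])
      (auto intro: continuous_on_subset[OF continuous_on_product_coordinates])
  then have "(\<lambda>x. x 0) -` {a} \<inter> space M \<in> sets M"
    by (rule measurable_sets) auto
  also have "(\<lambda>x. x 0) -` {a} \<inter> space M = cylinder d a"
    by (auto simp: cylinder_eq[OF assms(2)] space_borel_Omega[OF assms(1)])
  finally show ?thesis .
qed

lemma integrable_continuous_Omega:
  fixes f :: "(nat \<Rightarrow> nat) \<Rightarrow> real"
  assumes "sets M = sets (borel_Omega d)" "finite_measure M" "continuous_on (Omega d) f"
  shows "integrable M f"
proof -
  have "bounded (f ` Omega d)"
    by (intro compact_imp_bounded compact_continuous_image assms compact_Omega)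
  then obtain B where "\<forall>x\<in>Omega d. norm (f x) \<le> B"
    by (auto simp: bounded_iff)
  then show ?thesis
    by (intro finite_measure.integrable_const_bound[OF assms(2), of _ B] AE_I2
        borel_measurable_continuous_Omega[OF assms(1,3)])
      (auto simp: space_borel_Omega[OF assms(1)])
qed

text \<open>
  The Borel sets are generated by the boxes that constrain finitely many coordinates.  As the alphabet
  is discrete, the indicator of such a box is continuous, so the integrals of continuous functions
  determine the measure of every box.  This gives the uniqueness half of the Riesz theorem that the
  definition of the dual operator presupposes.
\<close>

lemma measure_Omega_eqI:
  assumes M: "sets M = sets (borel_Omega d)" "finite_measure M"
    and N: "sets N = sets (borel_Omega d)" "finite_measure N"
    and eq: "\<And>f :: _ \<Rightarrow> real. continuous_on (Omega d) f \<Longrightarrow> (\<integral>x. f x \<partial>M) = (\<integral>x. f x \<partial>N)"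
  shows "M = N"
proof -
  let ?P = "\<lambda>_::nat. borel :: nat measure"
  \<comment> \<open>Pushing forward along the inclusion into the full product makes the uniqueness theorem for
    product measures applicable.\<close>
  let ?E = "\<lambda>\<rho>. distr \<rho> (PiM UNIV ?P) (\<lambda>x. x)"
  have id: "(\<lambda>x. x) \<in> measurable \<rho> (PiM UNIV ?P)" if "sets \<rho> = sets (borel_Omega d)" for \<rho>
    using borel_measurable_continuous_Omega[OF that continuous_on_id]
      measurable_cong_sets[OF refl sets_PiM_equal_borel] by blast
  have box: "emeasure (?E \<rho>) (prod_emb UNIV ?P I (Pi\<^sub>E I F))
      = ennreal (\<integral>x. (\<Prod>i\<in>I. indicator (F i) (x i)) \<partial>\<rho>)"
    if \<rho>: "sets \<rho> = sets (borel_Omega d)" "finite_measure \<rho>" and I: "finite I" for \<rho> I F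
  proof -
    let ?B = "prod_emb UNIV ?P I (Pi\<^sub>E I F)"
    have B: "?B \<in> sets (PiM UNIV ?P)"
      using I by (intro sets_PiM_I) (auto simp: sets_borel_eq_count_space)
    have BM: "?B \<inter> space \<rho> \<in> sets \<rho>"
      using measurable_sets[OF id[OF \<rho>(1)] B] by simp
    have "emeasure (?E \<rho>) ?B = emeasure \<rho> (?B \<inter> space \<rho>)"
      using emeasure_distr[OF id[OF \<rho>(1)] B] by simp
    also have "\<dots> = ennreal (\<integral>x. indicator (?B \<inter> space \<rho>) x \<partial>\<rho>)"
      using BM \<rho>(2) by (simp add: finite_measure.emeasure_eq_measure)
    also have "(\<integral>x. indicator (?B \<inter> space \<rho>) x \<partial>\<rho>) = (\<integral>x. (\<Prod>i\<in>I. indicator (F i) (x i)) \<partial>\<rho> :: real)"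
      using I by (intro Bochner_Integration.integral_cong)
        (auto simp: prod_emb_def indicator_def PiE_iff prod_zero_iff space_PiM)
    finally show ?thesis .
  qed
  have "?E M = ?E N"
  proof (rule measure_eqI_PiM_infinite)
    fix A I assume I: "finite (I :: nat set)"
    have "continuous_on (Omega d) (\<lambda>x. \<Prod>i\<in>I. indicator (A i) (x i) :: real)"
    proof (rule continuous_on_prod)
      fix i
      show "continuous_on (Omega d) (\<lambda>x. indicator (A i) (x i) :: real)"
        by (rule continuous_on_compose2[of UNIV "indicator (A i)"])
          (auto intro: continuous_on_subset[OF continuous_on_product_coordinates])
    qed
    then show "emeasure (?E M) (prod_emb UNIV ?P I (Pi\<^sub>E I A))
        = emeasure (?E N) (prod_emb UNIV ?P I (Pi\<^sub>E I A))"
      by (simp add: box M N I eq)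
  qed (use finite_measure.finite_measure_distr[OF M(2) id[OF M(1)]] in auto)
  show "M = N"
  proof (rule measure_eqI)
    fix A assume "A \<in> sets M"
    then obtain A' where A': "A' \<in> sets borel" "A = A' \<inter> Omega d"
      by (auto simp: M(1) borel_Omega_def sets_restrict_space)
    have "emeasure \<rho> A = emeasure (?E \<rho>) A'" if "sets \<rho> = sets (borel_Omega d)" for \<rho>
      using A' emeasure_distr[OF id[OF that], of A'] space_borel_Omega[OF that]
      by (simp add: sets_PiM_equal_borel)
    then show "emeasure M A = emeasure N A"
      using M(1) N(1) \<open>?E M = ?E N\<close> by simp
  qed (simp add: M(1) N(1))
qed

section \<open>The change of variables given by an IRN\<close>

lemma borel_prob_sets: "borel_prob d M \<Longrightarrow> sets M = sets (borel_Omega d)"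
  by (simp add: borel_prob_def)

lemma borel_prob_finite: "borel_prob d M \<Longrightarrow> finite_measure M"
  by (simp add: borel_prob_def prob_space_def)

lemma is_IRN_continuous: "is_IRN d M K \<Longrightarrow> continuous_on (Omega d) K"
  by (simp add: is_IRN_def)

lemma is_IRN_pos: "is_IRN d M K \<Longrightarrow> x \<in> Omega d \<Longrightarrow> 0 < K x"
  by (simp add: is_IRN_def)

lemma jacobian_continuous: "is_jacobian d J \<Longrightarrow> continuous_on (Omega d) J"
  by (simp add: is_jacobian_def)

lemma jacobian_pos: "is_jacobian d J \<Longrightarrow> x \<in> Omega d \<Longrightarrow> 0 < J x"
  by (auto simp: is_jacobian_def)

lemma jacobian_sum: "is_jacobian d J \<Longrightarrow> x \<in> Omega d \<Longrightarrow> (\<Sum>a=1..d. J (scons a x)) = 1"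
  by (simp add: is_jacobian_def)

text \<open>
  The shift maps the cylinder of \<open>a\<close> bijectively onto the whole space, so a Borel set \<open>A\<close> is the
  image of exactly one set inside that cylinder; the IRN property of that set is the claim for \<open>A\<close>.
  As an identity of measures, it transfers to integrals.
\<close>

lemma distr_shift_IRN:
  assumes M: "borel_prob d M" and K: "is_IRN d M K" and a: "a \<in> {1..d}"
  shows "distr (density M (\<lambda>x. ennreal (indicator (cylinder d a) x / K x))) M shift = M"
proof -
  have s: "sets M = sets (borel_Omega d)" by (rule borel_prob_sets[OF M])
  note sp = space_borel_Omega[OF s]
  have cK: "continuous_on (Omega d) K" by (rule is_IRN_continuous[OF K])
  have [measurable]: "K \<in> borel_measurable M" by (rule borel_measurable_continuous_Omega[OF s cK])
  have [measurable]: "shift \<in> measurable M M" by (rule shift_measurable[OF s])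
  have [measurable]: "scons a \<in> measurable M M" by (rule scons_measurable[OF s a])
  have [measurable]: "cylinder d a \<in> sets M" by (rule cylinder_in_sets[OF s a])
  show ?thesis
  proof (rule measure_eqI)
    fix A assume "A \<in> sets (distr (density M (\<lambda>x. ennreal (indicator (cylinder d a) x / K x))) M shift)"
    then have A[measurable]: "A \<in> sets M" by simp
    have AO: "A \<subseteq> Omega d" using sets.sets_into_space[OF A] sp by simp
    define B where "B = (shift -` A \<inter> space M) \<inter> cylinder d a"
    have B[measurable]: "B \<in> sets M" unfolding B_def by measurable
    have shB: "shift ` B = A"
      using AO a by (force simp: B_def sp cylinder_eq scons_in_Omega image_iff
          intro!: bexI[of _ "scons a _"])
    have "emeasure (distr (density M (\<lambda>x. ennreal (indicator (cylinder d a) x / K x))) M shift) A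
        = emeasure (density M (\<lambda>x. ennreal (indicator (cylinder d a) x / K x))) (shift -` A \<inter> space M)"
      by (subst emeasure_distr) auto
    also have "\<dots> = (\<integral>\<^sup>+x. ennreal (indicator (cylinder d a) x / K x) * indicator (shift -` A \<inter> space M) x \<partial>M)"
      by (subst emeasure_density) auto
    also have "\<dots> = (\<integral>\<^sup>+x\<in>B. ennreal (inverse (K x)) \<partial>M)"
      by (intro nn_integral_cong) (auto simp: B_def indicator_def field_simps)
    also have "\<dots> = emeasure M (shift ` B)"
      using K a B s by (auto simp: is_IRN_def B_def)
    finally show "emeasure (distr (density M (\<lambda>x. ennreal (indicator (cylinder d a) x / K x))) M shift) A
        = emeasure M A"
      by (simp add: shB)
  qed simp
qed

lemma nn_integral_IRN:
  assumes M: "borel_prob d M" and K: "is_IRN d M K" and a: "a \<in> {1..d}"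
    and g: "g \<in> borel_measurable M"
  shows "(\<integral>\<^sup>+x. g x \<partial>M) = (\<integral>\<^sup>+x. ennreal (indicator (cylinder d a) x / K x) * g (shift x) \<partial>M)"
proof -
  have s: "sets M = sets (borel_Omega d)" by (rule borel_prob_sets[OF M])
  have cK: "continuous_on (Omega d) K" by (rule is_IRN_continuous[OF K])
  have [measurable]: "K \<in> borel_measurable M" by (rule borel_measurable_continuous_Omega[OF s cK])
  have [measurable]: "shift \<in> measurable M M" by (rule shift_measurable[OF s])
  have [measurable]: "cylinder d a \<in> sets M" by (rule cylinder_in_sets[OF s a])
  note g[measurable]
  have "(\<integral>\<^sup>+x. g x \<partial>M)
      = (\<integral>\<^sup>+x. g x \<partial>distr (density M (\<lambda>x. ennreal (indicator (cylinder d a) x / K x))) M shift)"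
    by (simp add: distr_shift_IRN[OF M K a])
  also have "\<dots> = (\<integral>\<^sup>+x. g (shift x) \<partial>density M (\<lambda>x. ennreal (indicator (cylinder d a) x / K x)))"
    by (subst nn_integral_distr) auto
  also have "\<dots> = (\<integral>\<^sup>+x. ennreal (indicator (cylinder d a) x / K x) * g (shift x) \<partial>M)"
    by (subst nn_integral_density) auto
  finally show ?thesis .
qed

lemma integral_IRN:
  fixes f :: "(nat \<Rightarrow> nat) \<Rightarrow> real"
  assumes M: "borel_prob d M" and K: "is_IRN d M K" and a: "a \<in> {1..d}"
    and f: "f \<in> borel_measurable M"
  shows "(\<integral>x. f x \<partial>M) = (\<integral>x. indicator (cylinder d a) x / K x * f (shift x) \<partial>M)"
proof -
  have s: "sets M = sets (borel_Omega d)" by (rule borel_prob_sets[OF M])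
  have cK: "continuous_on (Omega d) K" by (rule is_IRN_continuous[OF K])
  have [measurable]: "K \<in> borel_measurable M" by (rule borel_measurable_continuous_Omega[OF s cK])
  have [measurable]: "shift \<in> measurable M M" by (rule shift_measurable[OF s])
  have [measurable]: "cylinder d a \<in> sets M" by (rule cylinder_in_sets[OF s a])
  note f[measurable]
  have "(\<integral>x. f x \<partial>M)
      = (\<integral>x. f x \<partial>distr (density M (\<lambda>x. ennreal (indicator (cylinder d a) x / K x))) M shift)"
    by (simp add: distr_shift_IRN[OF M K a])
  also have "\<dots> = (\<integral>x. f (shift x) \<partial>density M (\<lambda>x. ennreal (indicator (cylinder d a) x / K x)))"
    by (subst integral_distr) auto
  also have "\<dots> = (\<integral>x. indicator (cylinder d a) x / K x * f (shift x) \<partial>M)"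
    by (subst integral_density)
      (auto simp: space_borel_Omega[OF s] intro!: AE_I2 divide_nonneg_pos is_IRN_pos[OF K])
  finally show ?thesis .
qed

section \<open>The image of a suitable probability under the dual operator\<close>

context
  fixes d :: nat and \<mu> :: "(nat \<Rightarrow> nat) measure" and J K :: "(nat \<Rightarrow> nat) \<Rightarrow> real"
  assumes \<mu>: "borel_prob d \<mu>" and K: "is_IRN d \<mu> K" and J: "is_jacobian d J"
begin

lemma continuous_IRN_ratio: "continuous_on (Omega d) (\<lambda>x. J x / K x)"
  by (intro continuous_on_divide jacobian_continuous[OF J] is_IRN_continuous[OF K])
    (use is_IRN_pos[OF K] in force)

text \<open>
  The integral against \<open>J / K\<close> splits over the cylinders, and on each of them the factor \<open>1 / K\<close> is
  what the change of variables along the shift absorbs.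
\<close>

lemma integral_density_IRN_ratio:
  fixes \<phi> :: "(nat \<Rightarrow> nat) \<Rightarrow> real"
  assumes \<phi>: "continuous_on (Omega d) \<phi>"
  shows "(\<integral>x. \<phi> x \<partial>density \<mu> (\<lambda>x. ennreal (J x / K x))) = (\<integral>x. ruelle_log d J \<phi> x \<partial>\<mu>)"
proof -
  note s = borel_prob_sets[OF \<mu>] note sp = space_borel_Omega[OF s]
  note meas = borel_measurable_continuous_Omega[OF s]
  have cyl: "cylinder d a \<in> sets \<mu>" if "a \<in> {1..d}" for a
    by (rule cylinder_in_sets[OF s that])
  have int: "integrable \<mu> (\<lambda>x. J x / K x * \<phi> x)"
    by (intro integrable_continuous_Omega[OF s borel_prob_finite[OF \<mu>]] continuous_on_mult continuous_IRN_ratio \<phi>)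
  have cont: "continuous_on (Omega d) (\<lambda>x. J (scons a x) * \<phi> (scons a x))" if "a \<in> {1..d}" for a
    by (intro continuous_on_mult continuous_on_compose_scons that jacobian_continuous[OF J] \<phi>)
  have "(\<integral>x. \<phi> x \<partial>density \<mu> (\<lambda>x. ennreal (J x / K x))) = (\<integral>x. J x / K x * \<phi> x \<partial>\<mu>)"
    by (subst integral_density)
      (auto simp: sp intro!: AE_I2 divide_nonneg_pos less_imp_le[OF jacobian_pos[OF J]] is_IRN_pos[OF K]
        meas[OF \<phi>] meas[OF continuous_IRN_ratio])
  also have "\<dots> = (\<integral>x. (\<Sum>a=1..d. indicator (cylinder d a) x * (J x / K x * \<phi> x)) \<partial>\<mu>)"
  proof (rule Bochner_Integration.integral_cong[OF refl])
    fix x assume "x \<in> space \<mu>"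
    then have x: "x \<in> Omega d" by (simp add: sp)
    then have x0: "x 0 \<in> {1..d}" by (auto simp: Omega_def)
    \<comment> \<open>The cylinders partition the space: only the one of the first symbol contains the point.\<close>
    have "(\<Sum>a=1..d. indicator (cylinder d a) x) = (\<Sum>a=1..d. if a = x 0 then 1 else 0 :: real)"
      using x by (intro sum.cong) (auto simp: cylinder_eq)
    then have "(\<Sum>a=1..d. indicator (cylinder d a) x) = (1::real)"
      using x0 by simp
    then show "J x / K x * \<phi> x = (\<Sum>a=1..d. indicator (cylinder d a) x * (J x / K x * \<phi> x))"
      by (simp only: sum_distrib_right[symmetric] mult_1_left)
  qed
  also have "\<dots> = (\<Sum>a=1..d. \<integral>x. indicator (cylinder d a) x * (J x / K x * \<phi> x) \<partial>\<mu>)"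
    using integrable_real_mult_indicator[OF cyl int]
    by (intro Bochner_Integration.integral_sum) (auto simp: mult.commute)
  also have "\<dots> = (\<Sum>a=1..d. \<integral>x. J (scons a x) * \<phi> (scons a x) \<partial>\<mu>)"
  proof (rule sum.cong[OF refl])
    fix a assume a: "a \<in> {1..d}"
    have "(\<integral>x. J (scons a x) * \<phi> (scons a x) \<partial>\<mu>) =
        (\<integral>x. indicator (cylinder d a) x / K x * (J (scons a (shift x)) * \<phi> (scons a (shift x))) \<partial>\<mu>)"
      by (rule integral_IRN[OF \<mu> K a meas[OF cont[OF a]]])
    also have "\<dots> = (\<integral>x. indicator (cylinder d a) x * (J x / K x * \<phi> x) \<partial>\<mu>)"
      using a by (intro Bochner_Integration.integral_cong)
        (auto simp: indicator_def cylinder_eq scons_shift)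
    finally show "(\<integral>x. indicator (cylinder d a) x * (J x / K x * \<phi> x) \<partial>\<mu>) =
        (\<integral>x. J (scons a x) * \<phi> (scons a x) \<partial>\<mu>)" ..
  qed
  also have "\<dots> = (\<integral>x. ruelle_log d J \<phi> x \<partial>\<mu>)"
    unfolding ruelle_log_def
    by (intro Bochner_Integration.integral_sum[symmetric]
        integrable_continuous_Omega[OF s borel_prob_finite[OF \<mu>]] cont)
  finally show ?thesis .
qed

lemma finite_density_IRN_ratio: "finite_measure (density \<mu> (\<lambda>x. ennreal (J x / K x)))"
proof -
  have "integrable \<mu> (\<lambda>x. J x / K x)"
    by (rule integrable_continuous_Omega[OF borel_prob_sets[OF \<mu>] borel_prob_finite[OF \<mu>] continuous_IRN_ratio])
  then have "(\<integral>\<^sup>+x. ennreal (J x / K x) \<partial>\<mu>) < \<infinity>"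
    using real_integrable_def by (fastforce simp: less_top)
  moreover have "emeasure (density \<mu> (\<lambda>x. ennreal (J x / K x))) (space \<mu>) = (\<integral>\<^sup>+x. ennreal (J x / K x) \<partial>\<mu>)"
    using borel_measurable_continuous_Omega[OF borel_prob_sets[OF \<mu>] continuous_IRN_ratio]
    by (subst emeasure_density) (auto intro!: nn_integral_cong)
  ultimately show ?thesis
    by (intro finite_measureI) simp
qed

lemma dual_ruelle_log_eq_density:
  "dual_ruelle_log d J \<mu> = density \<mu> (\<lambda>x. ennreal (J x / K x))"
  unfolding dual_ruelle_log_def
proof (rule the_equality)
  show "sets (density \<mu> (\<lambda>x. ennreal (J x / K x))) = sets (borel_Omega d) \<and>
    finite_measure (density \<mu> (\<lambda>x. ennreal (J x / K x))) \<and>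
    (\<forall>\<phi>. continuous_on (Omega d) \<phi> \<longrightarrow>
      (\<integral>x. \<phi> x \<partial>density \<mu> (\<lambda>x. ennreal (J x / K x))) = (\<integral>x. ruelle_log d J \<phi> x \<partial>\<mu>))"
    by (simp add: borel_prob_sets[OF \<mu>] finite_density_IRN_ratio integral_density_IRN_ratio)
  then show "\<nu> = density \<mu> (\<lambda>x. ennreal (J x / K x))"
    if "sets \<nu> = sets (borel_Omega d) \<and> finite_measure \<nu> \<and>
    (\<forall>\<phi>. continuous_on (Omega d) \<phi> \<longrightarrow> (\<integral>x. \<phi> x \<partial>\<nu>) = (\<integral>x. ruelle_log d J \<phi> x \<partial>\<mu>))" for \<nu>
    using that by (intro measure_Omega_eqI[of \<nu> d]) auto
qed

lemma borel_prob_dual_ruelle_log: "borel_prob d (dual_ruelle_log d J \<mu>)"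
proof -
  let ?\<nu> = "dual_ruelle_log d J \<mu>"
  interpret \<mu>: prob_space \<mu> using \<mu> by (simp add: borel_prob_def)
  interpret \<nu>: finite_measure ?\<nu> by (simp add: dual_ruelle_log_eq_density finite_density_IRN_ratio)
  \<comment> \<open>The total mass is the integral of the constant 1, which the Ruelle operator of a Jacobian fixes.\<close>
  have "measure ?\<nu> (space ?\<nu>) = (\<integral>x. 1 \<partial>?\<nu>)" by simp
  also have "\<dots> = (\<integral>x. ruelle_log d J (\<lambda>_. 1) x \<partial>\<mu>)"
    unfolding dual_ruelle_log_eq_density by (rule integral_density_IRN_ratio) auto
  also have "\<dots> = (\<integral>x. 1 \<partial>\<mu>)"
    using J by (intro Bochner_Integration.integral_cong)
      (auto simp: ruelle_log_def space_borel_Omega[OF borel_prob_sets[OF \<mu>]] is_jacobian_def)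
  finally have "emeasure ?\<nu> (space ?\<nu>) = 1"
    by (simp add: \<nu>.emeasure_eq_measure \<mu>.prob_space)
  then show ?thesis
    by (simp add: borel_prob_def prob_spaceI)
      (simp add: dual_ruelle_log_eq_density borel_prob_sets[OF \<mu>])
qed

text \<open>
  The formula is forced: passing from \<open>\<mu>\<close> to a measure of density \<open>r\<close> multiplies the IRN by
  the coboundary \<open>r x / r (shift x)\<close>, and here \<open>r = J / K\<close>, so that the factor \<open>K x\<close>
  cancels.
\<close>

lemma is_IRN_dual_ruelle_log:
  "is_IRN d (dual_ruelle_log d J \<mu>) (\<lambda>x. J x * K (shift x) / J (shift x))"
  unfolding is_IRN_def
proof (intro conjI ballI impI)
  note s = borel_prob_sets[OF \<mu>] note sp = space_borel_Omega[OF s]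
  let ?L = "\<lambda>x. J x * K (shift x) / J (shift x)"
  show cL: "continuous_on (Omega d) ?L"
    by (intro continuous_on_divide continuous_on_mult jacobian_continuous[OF J] continuous_on_compose_shift
        is_IRN_continuous[OF K])
      (use jacobian_pos[OF J] shift_in_Omega in force)
  show Lpos: "0 < ?L x" if "x \<in> Omega d" for x
    using that by (simp add: jacobian_pos[OF J] is_IRN_pos[OF K] shift_in_Omega)
  fix a B assume a: "a \<in> {1..d}" and B: "B \<in> sets (borel_Omega d)" and sub: "B \<subseteq> cylinder d a"
  have [measurable]: "B \<in> sets \<mu>" using B s by simp
  have [measurable]: "(\<lambda>x. J x / K x) \<in> borel_measurable \<mu>" "?L \<in> borel_measurable \<mu>"
    by (rule borel_measurable_continuous_Omega[OF s] continuous_IRN_ratio cL)+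
  have [measurable]: "scons a \<in> measurable \<mu> \<mu>" by (rule scons_measurable[OF s a])
  have shB: "shift ` B = scons a -` B \<inter> space \<mu>"
  proof
    show "shift ` B \<subseteq> scons a -` B \<inter> space \<mu>"
      using sub a by (auto simp: sp cylinder_eq scons_shift shift_in_Omega)
    show "scons a -` B \<inter> space \<mu> \<subseteq> shift ` B"
      by (auto intro!: image_eqI[of _ shift "scons a _"])
  qed
  have [measurable]: "shift ` B \<in> sets \<mu>" unfolding shB by measurable
  have "emeasure (dual_ruelle_log d J \<mu>) (shift ` B)
      = (\<integral>\<^sup>+x. ennreal (J x / K x) * indicator (shift ` B) x \<partial>\<mu>)"
    unfolding dual_ruelle_log_eq_density by (subst emeasure_density) auto
  also have "\<dots> = (\<integral>\<^sup>+x. ennreal (indicator (cylinder d a) x / K x) *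
      (ennreal (J (shift x) / K (shift x)) * indicator (shift ` B) (shift x)) \<partial>\<mu>)"
    by (rule nn_integral_IRN[OF \<mu> K a]) measurable
  also have "\<dots> = (\<integral>\<^sup>+x. ennreal (J x / K x) * (ennreal (inverse (?L x)) * indicator B x) \<partial>\<mu>)"
  proof (rule nn_integral_cong)
    fix x assume "x \<in> space \<mu>"
    then have x: "x \<in> Omega d" and sx: "shift x \<in> Omega d" by (auto simp: sp shift_in_Omega)
    show "ennreal (indicator (cylinder d a) x / K x) *
        (ennreal (J (shift x) / K (shift x)) * indicator (shift ` B) (shift x)) =
        ennreal (J x / K x) * (ennreal (inverse (?L x)) * indicator B x)"
    proof (cases "x \<in> cylinder d a")
      case True
      then have "shift x \<in> shift ` B \<longleftrightarrow> x \<in> B"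
        using a sx by (auto simp: shB sp cylinder_eq scons_shift)
      moreover have "1 / K x * (J (shift x) / K (shift x)) = J x / K x * inverse (?L x)"
        using jacobian_pos[OF J x] jacobian_pos[OF J sx] is_IRN_pos[OF K x] is_IRN_pos[OF K sx]
        by (simp add: field_simps)
      ultimately show ?thesis
        using True jacobian_pos[OF J x] jacobian_pos[OF J sx] is_IRN_pos[OF K x] is_IRN_pos[OF K sx]
        by (simp add: indicator_def ennreal_mult[symmetric])
    next
      case False
      then show ?thesis using sub by (auto simp: indicator_def)
    qed
  qed
  also have "\<dots> = (\<integral>\<^sup>+x\<in>B. ennreal (inverse (?L x)) \<partial>dual_ruelle_log d J \<mu>)"
    unfolding dual_ruelle_log_eq_density by (rule nn_integral_density[symmetric]) measurable
  finally show "emeasure (dual_ruelle_log d J \<mu>) (shift ` B) =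
      (\<integral>\<^sup>+x\<in>B. ennreal (inverse (?L x)) \<partial>dual_ruelle_log d J \<mu>)" .
qed

end

section \<open>Independence of the choice of the IRN\<close>

lemma is_IRN_IRN: "is_IRN d M K \<Longrightarrow> is_IRN d M (IRN d M)"
  unfolding IRN_def by (rule someI[of "is_IRN d M"])

text \<open>
  On a fixed cylinder the IRN property prescribes the integral of \<open>1 / K\<close> over every Borel subset, and
  a density is determined almost everywhere by its integrals.  The finitely many cylinders cover the
  space.
\<close>

lemma is_IRN_AE_unique:
  assumes M: "borel_prob d M" and K: "is_IRN d M K" and L: "is_IRN d M L"
  shows "AE x in M. K x = L x"
proof -
  have s: "sets M = sets (borel_Omega d)" by (rule borel_prob_sets[OF M])
  interpret prob_space M using M by (simp add: borel_prob_def)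
  note sp = space_borel_Omega[OF s]
  have cont: "continuous_on (Omega d) K" "continuous_on (Omega d) L"
    and pos: "\<And>x. x \<in> Omega d \<Longrightarrow> 0 < K x" "\<And>x. x \<in> Omega d \<Longrightarrow> 0 < L x"
    using K L by (auto simp: is_IRN_def)
  have [measurable]: "K \<in> borel_measurable M" "L \<in> borel_measurable M"
    by (rule borel_measurable_continuous_Omega[OF s] cont)+
  have cyl: "AE x in M. x \<in> cylinder d a \<longrightarrow> K x = L x" if a: "a \<in> {1..d}" for a
  proof -
    have [measurable]: "cylinder d a \<in> sets M" by (rule cylinder_in_sets[OF s a])
    have "AE x in M. ennreal (inverse (K x)) * indicator (cylinder d a) x
        = ennreal (inverse (L x)) * indicator (cylinder d a) x"
    proof (rule density_unique_finite_measure)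
      fix A assume [measurable]: "A \<in> sets M"
      have B: "A \<inter> cylinder d a \<in> sets (borel_Omega d)" unfolding s[symmetric] by measurable
      have eq: "emeasure M (shift ` (A \<inter> cylinder d a)) =
          (\<integral>\<^sup>+x. ennreal (inverse (H x)) * indicator (cylinder d a) x * indicator A x \<partial>M)"
        if "is_IRN d M H" for H
      proof -
        have "emeasure M (shift ` (A \<inter> cylinder d a)) = (\<integral>\<^sup>+x\<in>A \<inter> cylinder d a. ennreal (inverse (H x)) \<partial>M)"
          using that a B unfolding is_IRN_def by blast
        also have "\<dots> = (\<integral>\<^sup>+x. ennreal (inverse (H x)) * indicator (cylinder d a) x * indicator A x \<partial>M)"
          by (intro nn_integral_cong) (auto simp: indicator_def)
        finally show ?thesis .
      qed
      show "(\<integral>\<^sup>+x. ennreal (inverse (K x)) * indicator (cylinder d a) x * indicator A x \<partial>M) =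
          (\<integral>\<^sup>+x. ennreal (inverse (L x)) * indicator (cylinder d a) x * indicator A x \<partial>M)"
        using eq[OF K] eq[OF L] by simp
    qed auto
    then show ?thesis
      using AE_space
      by eventually_elim (auto simp: sp indicator_def ennreal_inj less_imp_le pos)
  qed
  have "AE x in M. \<forall>a\<in>{1..d}. x \<in> cylinder d a \<longrightarrow> K x = L x"
    using cyl by (subst AE_ball_countable) auto
  then show ?thesis
    using AE_space
  proof eventually_elim
    case (elim x)
    then have "x 0 \<in> {1..d}" by (auto simp: sp Omega_def)
    with elim show ?case by (auto simp: sp cylinder_eq)
  qed
qed

lemma integral_ln_IRN:
  assumes M: "borel_prob d M" and K: "is_IRN d M K"
  shows "(\<integral>x. ln (IRN d M x) \<partial>M) = (\<integral>x. ln (K x) \<partial>M)"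
proof -
  have s: "sets M = sets (borel_Omega d)" by (rule borel_prob_sets[OF M])
  have meas: "H \<in> borel_measurable M" if "is_IRN d M H" for H
    using that by (intro borel_measurable_continuous_Omega[OF s]) (simp add: is_IRN_def)
  have [measurable]: "IRN d M \<in> borel_measurable M" "K \<in> borel_measurable M"
    using meas K is_IRN_IRN[OF K] by auto
  show ?thesis
  proof (rule integral_cong_AE)
    show "AE x in M. ln (IRN d M x) = ln (K x)"
      using is_IRN_AE_unique[OF M is_IRN_IRN[OF K] K] by eventually_elim simp
  qed auto
qed

section \<open>Entropy production\<close>

text \<open>
  The logarithm splits into \<open>ln (K x)\<close>, which the weights of total mass one reproduce, and
  \<open>ln (J (scons a x) / J x)\<close>, to which \<open>ln t \<le> t - 1\<close> applies.
\<close>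

lemma ruelle_log_ln_IRN_le:
  assumes J: "is_jacobian d J" and x: "x \<in> Omega d" and K: "0 < K x"
  shows "ruelle_log d J (\<lambda>y. ln (J y * K (shift y) / J (shift y))) x
    \<le> (\<Sum>a=1..d. (J (scons a x))\<^sup>2 / J x) - 1 + ln (K x)"
proof -
  note pos = jacobian_pos[OF J]
  have one: "(\<Sum>a=1..d. J (scons a x)) = 1"
    by (rule jacobian_sum[OF J x])
  have "ruelle_log d J (\<lambda>y. ln (J y * K (shift y) / J (shift y))) x
      = (\<Sum>a=1..d. J (scons a x) * ln (J (scons a x) * K x / J x))"
    by (simp add: ruelle_log_def)
  also have "\<dots> \<le> (\<Sum>a=1..d. (J (scons a x))\<^sup>2 / J x - J (scons a x) + J (scons a x) * ln (K x))"
  proof (rule sum_mono)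
    fix a assume a: "a \<in> {1..d}"
    have p: "0 < J (scons a x)" "0 < J x" using a x pos scons_in_Omega by blast+
    have "ln (J (scons a x) * K x / J x) = ln (J (scons a x) / J x) + ln (K x)"
      using p K by (simp add: ln_mult ln_div)
    also have "\<dots> \<le> J (scons a x) / J x - 1 + ln (K x)"
      using p by (intro add_right_mono ln_le_minus_one) simp
    finally have "J (scons a x) * ln (J (scons a x) * K x / J x)
        \<le> J (scons a x) * (J (scons a x) / J x - 1 + ln (K x))"
      using p by (intro mult_left_mono) auto
    then show "J (scons a x) * ln (J (scons a x) * K x / J x)
        \<le> (J (scons a x))\<^sup>2 / J x - J (scons a x) + J (scons a x) * ln (K x)"
      by (simp add: algebra_simps power2_eq_square)
  qed
  also have "\<dots> = (\<Sum>a=1..d. (J (scons a x))\<^sup>2 / J x) - 1 + ln (K x)"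
    by (simp add: sum.distrib sum_subtractf sum_distrib_right[symmetric] one[simplified])
  finally show ?thesis .
qed

text \<open>
  This quantitative form contains the second law: the entropy cannot drop as soon as the gain term is
  nonnegative.
\<close>

lemma entropy_gain_lower_bound:
  assumes \<mu>: "borel_prob d \<mu>" and K: "is_IRN d \<mu> K" and J: "is_jacobian d J"
  shows "IRN_entropy d \<mu> + (1 - (\<integral>x. (\<Sum>a=1..d. (J (scons a x))\<^sup>2 / J x) \<partial>\<mu>))
    \<le> IRN_entropy d (dual_ruelle_log d J \<mu>)"
proof -
  let ?\<nu> = "dual_ruelle_log d J \<mu>" and ?L = "\<lambda>x. J x * K (shift x) / J (shift x)"
  let ?S = "\<lambda>x. \<Sum>a=1..d. (J (scons a x))\<^sup>2 / J x"
  interpret prob_space \<mu> using \<mu> by (simp add: borel_prob_def)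
  note ctx = \<mu> K J
  note int = integrable_continuous_Omega[OF borel_prob_sets[OF \<mu>] borel_prob_finite[OF \<mu>]]
  have L: "is_IRN d ?\<nu> ?L" by (rule is_IRN_dual_ruelle_log[OF ctx])
  have clnL: "continuous_on (Omega d) (\<lambda>x. ln (?L x))"
    using L by (intro continuous_on_ln) (auto simp: is_IRN_def less_imp_neq[symmetric])
  have clnK: "continuous_on (Omega d) (\<lambda>x. ln (K x))"
    using K by (intro continuous_on_ln) (auto simp: is_IRN_def less_imp_neq[symmetric])
  have cS: "continuous_on (Omega d) ?S"
    by (intro continuous_on_sum continuous_on_divide continuous_on_power continuous_on_compose_scons
        jacobian_continuous[OF J]) (use jacobian_pos[OF J] in force)+
  have iK: "integrable \<mu> (\<lambda>x. ln (K x))" and iS: "integrable \<mu> ?S"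
    by (rule int clnK cS)+
  have "(\<integral>x. ln (IRN d ?\<nu> x) \<partial>?\<nu>) = (\<integral>x. ln (?L x) \<partial>?\<nu>)"
    by (rule integral_ln_IRN[OF borel_prob_dual_ruelle_log[OF ctx] L])
  also have "\<dots> = (\<integral>x. ruelle_log d J (\<lambda>x. ln (?L x)) x \<partial>\<mu>)"
    unfolding dual_ruelle_log_eq_density[OF ctx] by (rule integral_density_IRN_ratio[OF ctx clnL])
  also have "\<dots> \<le> (\<integral>x. ?S x - 1 + ln (K x) \<partial>\<mu>)"
  proof (rule integral_mono)
    show "integrable \<mu> (ruelle_log d J (\<lambda>x. ln (?L x)))"
      by (intro int continuous_on_ruelle_log jacobian_continuous[OF J] clnL)
    show "integrable \<mu> (\<lambda>x. ?S x - 1 + ln (K x))"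
      using iK iS by simp
    show "ruelle_log d J (\<lambda>x. ln (?L x)) x \<le> ?S x - 1 + ln (K x)" if "x \<in> space \<mu>" for x
      using that is_IRN_pos[OF K] space_borel_Omega[OF borel_prob_sets[OF \<mu>]]
      by (intro ruelle_log_ln_IRN_le[OF J]) auto
  qed
  also have "\<dots> = (\<integral>x. ?S x \<partial>\<mu>) - 1 + (\<integral>x. ln (K x) \<partial>\<mu>)"
    using iK iS by (simp add: prob_space)
  also have "(\<integral>x. ln (K x) \<partial>\<mu>) = (\<integral>x. ln (IRN d \<mu> x) \<partial>\<mu>)"
    by (rule integral_ln_IRN[OF \<mu> K, symmetric])
  finally show ?thesis
    by (simp add: IRN_entropy_def)
qed

theorem theorem29:
  fixes d :: nat
    and \<mu>1 \<mu>2 :: "(nat \<Rightarrow> nat) measure"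
    and J J1 J2 :: "(nat \<Rightarrow> nat) \<Rightarrow> real"
  assumes "d \<ge> 2"
    and "suitable d \<mu>1"
    and "is_jacobian d J"
    and "\<mu>2 = dual_ruelle_log d J \<mu>1"
    and "J1 = IRN d \<mu>1"
    and "J2 = IRN d \<mu>2"
    and "1 - (\<integral>x. (\<Sum>a=1..d. (J (scons a x))\<^sup>2 / J x) \<partial>\<mu>1) \<ge> 0"
  shows "IRN_entropy d (dual_ruelle_log d J \<mu>1) = IRN_entropy d \<mu>2 \<and>
         IRN_entropy d \<mu>2 = - (\<integral>x. ln (J2 x) \<partial>\<mu>2) \<and>
         - (\<integral>x. ln (J2 x) \<partial>\<mu>2) \<ge> - (\<integral>x. ln (J1 x) \<partial>\<mu>1) \<and>
         - (\<integral>x. ln (J1 x) \<partial>\<mu>1) = IRN_entropy d \<mu>1"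
proof -
  obtain K where K: "borel_prob d \<mu>1" "is_IRN d \<mu>1 K"
    using assms(2) by (auto simp: suitable_def)
  have "IRN_entropy d \<mu>1 \<le> IRN_entropy d \<mu>2"
    using entropy_gain_lower_bound[OF K assms(3)] assms(7) unfolding assms(4) by linarith
  then show ?thesis
    by (simp add: assms(4-6) IRN_entropy_def)
qed

end
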